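(* Let $b>0$ and let $R\subset\mathbb{R}^2$ be the square (interior) with vertices $(\pm2b,0)$ and $(0,\pm2b)$ in the $(x,t)$-plane, with closure $\overline{R}$. Let $w\in C^2(\overline{R})$ be a solution of the wave equation $w_{xx}-w_{tt}=0$ in $R$. Then there exists a sequence of wave polynomials $P_N=\sum_{n=0}^{N}a_np_n$ (the coefficients $a_n$ may depend on $N$) uniformly convergent to $w$ in $\overline{R}$.
   Context: The polynomials $p_m$ are $p_0(x,t)=1$ and, for $n\ge 1$, $p_{2n-1}(x,t)=\frac12\big((x+t)^n+(x-t)^n\big)$ and $p_{2n}(x,t)=\frac12\big((x+t)^n-(x-t)^n\big)$. Wave polynomials are the $p_m$ and their finite linear combinations. *)

theory Defs
  imports "HOL-Analysis.Analysis"
begin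

definition wave_poly :: "nat \<Rightarrow> real \<Rightarrow> real \<Rightarrow> real" where
  "wave_poly m x t =
    (if m = 0 then 1
     else if odd m then ((x + t) ^ ((m + 1) div 2) + (x - t) ^ ((m + 1) div 2)) / 2
     else ((x + t) ^ (m div 2) - (x - t) ^ (m div 2)) / 2)"

lemma wave_poly_0: "wave_poly 0 x t = 1"
  by (simp add: wave_poly_def)

lemma wave_poly_odd:
  assumes "n \<ge> 1"
  shows "wave_poly (2 * n - 1) x t = ((x + t) ^ n + (x - t) ^ n) / 2"
  using assms by (simp add: wave_poly_def)

lemma wave_poly_even:
  assumes "n \<ge> 1"
  shows "wave_poly (2 * n) x t = ((x + t) ^ n - (x - t) ^ n) / 2"
  using assms by (simp add: wave_poly_def)

definition wave_square :: "real \<Rightarrow> (real \<times> real) set" where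
  "wave_square b = interior (convex hull {(2 * b, 0), (- 2 * b, 0), (0, 2 * b), (0, - 2 * b)})"

definition partial_x :: "(real \<times> real \<Rightarrow> 'a::real_normed_vector) \<Rightarrow> real \<times> real \<Rightarrow> 'a" where
  "partial_x f = (\<lambda>(x, t). vector_derivative (\<lambda>s. f (s, t)) (at x))"

definition partial_t :: "(real \<times> real \<Rightarrow> 'a::real_normed_vector) \<Rightarrow> real \<times> real \<Rightarrow> 'a" where
  "partial_t f = (\<lambda>(x, t). vector_derivative (\<lambda>s. f (x, s)) (at t))"

definition has_partials_on :: "(real \<times> real \<Rightarrow> 'a::real_normed_vector) \<Rightarrow> (real \<times> real) set \<Rightarrow> bool" where
  "has_partials_on f S \<longleftrightarrow>
    (\<forall>(x, t)\<in>S. (\<lambda>s. f (s, t)) differentiable (at x) \<and> (\<lambda>s. f (x, s)) differentiable (at t))"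

definition extends_to_closure :: "(real \<times> real \<Rightarrow> 'a::real_normed_vector) \<Rightarrow> (real \<times> real) set \<Rightarrow> bool" where
  "extends_to_closure f S \<longleftrightarrow> (\<exists>g. continuous_on (closure S) g \<and> (\<forall>p\<in>S. g p = f p))"

text \<open>The class $C^2$ of the closure of an open set \<open>S\<close>: the function is continuous on the
  closure, and all its partial derivatives of order one and two exist in \<open>S\<close> and have continuous
  extensions to the closure. Only values of the derivatives at points of \<open>S\<close> matter.\<close>

definition C2_closure :: "(real \<times> real \<Rightarrow> 'a::real_normed_vector) \<Rightarrow> (real \<times> real) set \<Rightarrow> bool" where
  "C2_closure w S \<longleftrightarrow>
    continuous_on (closure S) w \<and>
    has_partials_on w S \<and> has_partials_on (partial_x w) S \<and> has_partials_on (partial_t w) S \<and>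
    (\<forall>D \<in> {partial_x w, partial_t w,
           partial_x (partial_x w), partial_t (partial_x w),
           partial_x (partial_t w), partial_t (partial_t w)}. extends_to_closure D S)"

end

theory Submission
  imports Defs
begin

text \<open>
  In the characteristic coordinates \<open>u = x + t\<close>, \<open>v = x - t\<close> the square is the product
  \<open>\<bar>u\<bar> < 2b\<close>, \<open>\<bar>v\<bar> < 2b\<close>, and the wave equation says that the mixed derivative in \<open>u\<close> and \<open>v\<close>
  vanishes. Hence a solution splits as \<open>w(x, t) = F(x + t) + G(x - t)\<close>
  (\<open>dAlembert_decomposition\<close>), where \<open>F\<close> and \<open>G\<close> are restrictions of \<open>w\<close> to the two diagonals
  \<open>v = 0\<close> and \<open>u = 0\<close>, up to a constant. These diagonals reach the boundary, so \<open>F\<close> and \<open>G\<close> are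
  continuous on the closed interval \<open>[-2b, 2b]\<close>, and by continuity the splitting persists on the
  closed square.

  By the Weierstrass theorem both functions are uniform limits of polynomials, and Bernstein
  polynomials even give one of degree at most \<open>m\<close> for the index \<open>m\<close> (\<open>Weierstrass_euclidean\<close>).
  Since \<open>u\<^sup>i = p\<^bsub>2i-1\<^esub> + p\<^bsub>2i\<^esub>\<close> and \<open>v\<^sup>i = p\<^bsub>2i-1\<^esub> - p\<^bsub>2i\<^esub>\<close> for \<open>i \<ge> 1\<close>, a polynomial of
  degree \<open>m\<close> in \<open>u\<close> plus one in \<open>v\<close> is a combination of \<open>p\<^sub>0, \<dots>, p\<^bsub>2m\<^esub>\<close>
  (\<open>sum_wave_coeff\<close>). The approximant with index \<open>N\<close> therefore uses degree \<open>m = N div 2\<close>.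

  The differential part has two steps. The chain rule along characteristics needs total
  derivatives, which exist because the partial derivatives are continuous
  (\<open>has_derivative_from_partials\<close>). And the derivative of \<open>w\<^sub>x - w\<^sub>t\<close> in the direction \<open>(1, 1)\<close> is
  \<open>w\<^sub>x\<^sub>x - w\<^sub>t\<^sub>t\<close> only up to the difference of the two mixed derivatives, which vanishes by
  Schwarz's theorem (\<open>mixed_partials_eq\<close>).
\<close>

section \<open>The square in characteristic coordinates\<close>

lemma wave_square_hull:
  assumes "b > 0"
  shows "convex hull {(2 * b, 0), (- 2 * b, 0), (0, 2 * b), (0, - 2 * b)}
    = {(x::real, t). \<bar>x + t\<bar> \<le> 2 * b \<and> \<bar>x - t\<bar> \<le> 2 * b}" (is "convex hull ?V = ?K")
proof (rule antisym)
  have "?K = (\<lambda>p. fst p + snd p) -` {-2*b..2*b} \<inter> (\<lambda>p. fst p - snd p) -` {-2*b..2*b}"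
    by auto
  moreover have "convex \<dots>"
    by (intro convex_Int convex_linear_vimage convex_real_interval)
      (auto intro!: linearI simp: algebra_simps)
  ultimately have "convex ?K" by metis
  then show "convex hull ?V \<subseteq> ?K"
    using assms by (intro hull_minimal) auto
  show "?K \<subseteq> convex hull ?V"
  proof
    fix p assume p: "p \<in> ?K"
    obtain x t where xt: "p = (x, t)" by (cases p)
    \<comment> \<open>These are the positions of \<open>x + t\<close> and \<open>x - t\<close> within the interval \<open>[-2b, 2b]\<close>, rescaled to
      \<open>[0, 1]\<close>. Interpolating first in \<open>x - t\<close> along two opposite sides and then in \<open>x + t\<close> exhibits the
      point as a convex combination of the vertices.\<close>
    define \<alpha> where "\<alpha> = (x + t + 2 * b) / (4 * b)"
    define \<beta> where "\<beta> = (x - t + 2 * b) / (4 * b)"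
    have r: "0 \<le> \<alpha>" "\<alpha> \<le> 1" "0 \<le> \<beta>" "\<beta> \<le> 1"
      using p assms by (auto simp: xt \<alpha>_def \<beta>_def field_simps)
    have cvx: "convex (convex hull ?V)" by simp
    have v: "(2 * b, 0) \<in> convex hull ?V" "(- 2 * b, 0) \<in> convex hull ?V"
      "(0, 2 * b) \<in> convex hull ?V" "(0, - 2 * b) \<in> convex hull ?V"
      by (auto intro!: hull_inc)
    have "\<beta> *\<^sub>R (2 * b, 0) + (1 - \<beta>) *\<^sub>R (0, 2 * b) \<in> convex hull ?V" (is "?q1 \<in> _")
      using v r by (intro convexD[OF cvx]) auto
    moreover have "\<beta> *\<^sub>R (0, - 2 * b) + (1 - \<beta>) *\<^sub>R (- 2 * b, 0) \<in> convex hull ?V" (is "?q2 \<in> _")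
      using v r by (intro convexD[OF cvx]) auto
    ultimately have "\<alpha> *\<^sub>R ?q1 + (1 - \<alpha>) *\<^sub>R ?q2 \<in> convex hull ?V"
      using r by - (rule convexD[OF cvx], auto)
    moreover have "\<alpha> *\<^sub>R ?q1 + (1 - \<alpha>) *\<^sub>R ?q2 = p"
    proof -
      have "2 * b * (\<alpha> + \<beta> - 1) = x" "2 * b * (\<alpha> - \<beta>) = t"
        using assms by (auto simp: \<alpha>_def \<beta>_def field_simps)
      then have "p = (2 * b * (\<alpha> + \<beta> - 1), 2 * b * (\<alpha> - \<beta>))" by (simp add: xt)
      then show ?thesis by (simp add: algebra_simps)
    qed
    ultimately show "p \<in> convex hull ?V" by simp
  qed
qed

lemma wave_square_eq:
  assumes "b > 0"
  shows "wave_square b = {(x, t). \<bar>x + t\<bar> < 2 * b \<and> \<bar>x - t\<bar> < 2 * b}" (is "_ = ?Q")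
proof (rule antisym)
  define K where "K = {(x::real, t). \<bar>x + t\<bar> \<le> 2 * b \<and> \<bar>x - t\<bar> \<le> 2 * b}"
  have S: "wave_square b = interior K"
    unfolding wave_square_def wave_square_hull[OF assms] K_def ..
  have "?Q = {p. \<bar>fst p + snd p\<bar> < 2 * b} \<inter> {p. \<bar>fst p - snd p\<bar> < 2 * b}" by auto
  moreover have "open \<dots>"
    by (intro open_Int open_Collect_less continuous_intros)
  ultimately have "open ?Q" by metis
  then show "?Q \<subseteq> wave_square b"
    unfolding S by (intro interior_maximal) (auto simp: K_def)
  show "wave_square b \<subseteq> ?Q"
  proof
    fix p assume "p \<in> wave_square b"
    then obtain e where e: "e > 0" "ball p e \<subseteq> K"
      unfolding S mem_interior by blast
    obtain x t where xt: "p = (x, t)" by (cases p)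
    \<comment> \<open>Moving right raises both \<open>x + t\<close> and \<open>x - t\<close>, moving left lowers both: so neither can attain
      its bound at an interior point.\<close>
    have "(x + e/2, t) \<in> K" "(x - e/2, t) \<in> K"
      using e by (auto intro!: subsetD[OF e(2)] simp: xt dist_Pair_Pair dist_real_def)
    then show "p \<in> ?Q" using e(1) by (auto simp: K_def xt)
  qed
qed

lemma closure_wave_square:
  assumes "b > 0"
  shows "closure (wave_square b) = {(x, t). \<bar>x + t\<bar> \<le> 2 * b \<and> \<bar>x - t\<bar> \<le> 2 * b}"
proof -
  let ?H = "convex hull {(2 * b, 0), (- 2 * b, 0), (0, 2 * b), (0, - 2 * b)}"
  have "(0, 0) \<in> interior ?H"
    using wave_square_eq[OF assms] assms by (auto simp: wave_square_def)
  then have "closure (interior ?H) = closure ?H"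
    by (intro convex_closure_interior) auto
  also have "\<dots> = ?H"
    by (intro closure_closed compact_imp_closed finite_imp_compact_convex_hull) auto
  finally show ?thesis
    unfolding wave_square_def wave_square_hull[OF assms] by simp
qed

section \<open>Total derivatives and symmetry of mixed partial derivatives\<close>

lemma has_partials_onD:
  assumes "has_partials_on f S" "(x, t) \<in> S"
  shows "((\<lambda>s. f (s, t)) has_vector_derivative partial_x f (x, t)) (at x)"
    and "((\<lambda>s. f (x, s)) has_vector_derivative partial_t f (x, t)) (at t)"
  using assms by (auto simp: has_partials_on_def partial_x_def partial_t_def vector_derivative_works)

text \<open>
  The increment of \<open>f\<close> is split into one step in \<open>x\<close> and one in \<open>t\<close>; continuity of \<open>partial_t f\<close>
  makes the error of the second step uniform in the first. Both steps stay in \<open>S\<close> because the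
  point is enclosed in an open rectangle inside \<open>S\<close>.
\<close>

lemma has_derivative_from_partials:
  assumes S: "open S" "(x, t) \<in> S" and f: "has_partials_on f S"
    and cont: "continuous_on S (partial_t f)"
  shows "(f has_derivative (\<lambda>(h, k). h *\<^sub>R partial_x f (x, t) + k *\<^sub>R partial_t f (x, t))) (at (x, t))"
proof -
  obtain X Y0 where X: "open X" "open Y0" "(x, t) \<in> X \<times> Y0" "X \<times> Y0 \<subseteq> S"
    using open_prod_elim[OF S] .
  then obtain e where e: "e > 0" "ball t e \<subseteq> Y0" by (auto simp: open_contains_ball)
  define Y where "Y = ball t e"
  have XY: "open (X \<times> Y)" "(x, t) \<in> X \<times> Y" "X \<times> Y \<subseteq> S"
    using X e by (auto simp: Y_def open_Times)
  have "((\<lambda>(x, t). f (x, t)) has_derivative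
      (\<lambda>(h, k). h *\<^sub>R partial_x f (x, t) + blinfun_scaleR_left (partial_t f (x, t)) k))
      (at (x, t) within X \<times> Y)"
  proof (rule has_derivative_partialsI[where fy = "\<lambda>x y. blinfun_scaleR_left (partial_t f (x, y))"])
    show "((\<lambda>x. f (x, t)) has_derivative (\<lambda>h. h *\<^sub>R partial_x f (x, t))) (at x within X)"
      using has_partials_onD(1)[OF f S(2)]
      by (auto simp: has_vector_derivative_def intro: has_derivative_at_withinI)
    show "((\<lambda>y. f (x', y)) has_derivative blinfun_scaleR_left (partial_t f (x', y))) (at y within Y)"
      if "x' \<in> X" "y \<in> Y" for x' y
      using has_partials_onD(2)[OF f, of x' y] that XY(3)
      by (auto simp: has_vector_derivative_def intro: has_derivative_at_withinI)
    have "continuous (at (x, t) within X \<times> Y) (partial_t f)"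
      using continuous_on_subset[OF cont XY(3)] XY(2) by (simp add: continuous_on_eq_continuous_within)
    then have "continuous (at (x, t) within X \<times> Y) (\<lambda>p. blinfun_scaleR_left (partial_t f p))"
      by (intro bounded_linear.continuous[OF bounded_linear_blinfun_scaleR_left])
    then show "continuous (at (x, t) within X \<times> Y) (\<lambda>(x, y). blinfun_scaleR_left (partial_t f (x, y)))"
      by (simp add: case_prod_unfold)
  qed (use XY in \<open>auto simp: Y_def\<close>)
  then show ?thesis
    using XY by (simp add: at_within_open[of _ "X \<times> Y"] case_prod_unfold)
qed

text \<open>
  The mean value theorem is applied first in \<open>x\<close>, to the difference of \<open>f\<close> on two horizontal lines,
  and then in \<open>t\<close>. The second difference is symmetric in the two variables, which is what makes the
  mixed derivatives comparable.
\<close>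

lemma second_difference_mean_value:
  fixes f fx fxt :: "real \<times> real \<Rightarrow> real"
  assumes r: "r > 0" and S: "{x..x+r} \<times> {t..t+r} \<subseteq> S"
    and fx: "\<And>x t. (x, t) \<in> S \<Longrightarrow> ((\<lambda>s. f (s, t)) has_vector_derivative fx (x, t)) (at x)"
    and fxt: "\<And>x t. (x, t) \<in> S \<Longrightarrow> ((\<lambda>s. fx (x, s)) has_vector_derivative fxt (x, t)) (at t)"
  obtains \<xi> \<eta> where "\<xi> \<in> {x..x+r}" "\<eta> \<in> {t..t+r}"
    "f (x + r, t + r) - f (x + r, t) - f (x, t + r) + f (x, t) = r * (r * fxt (\<xi>, \<eta>))"
proof -
  have "\<exists>\<xi>. x < \<xi> \<and> \<xi> < x + r \<and>
      (f (x + r, t + r) - f (x + r, t)) - (f (x, t + r) - f (x, t)) =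
      ((x + r) - x) * (fx (\<xi>, t + r) - fx (\<xi>, t))"
  proof (rule MVT2)
    show "((\<lambda>s. f (s, t + r) - f (s, t)) has_real_derivative (fx (y, t + r) - fx (y, t))) (at y)"
      if "x \<le> y" "y \<le> x + r" for y
      using that r S
      by (intro DERIV_diff) (auto intro!: fx simp: has_real_derivative_iff_has_vector_derivative)
  qed (use r in auto)
  then obtain \<xi> where \<xi>: "x < \<xi>" "\<xi> < x + r"
      "f (x + r, t + r) - f (x + r, t) - f (x, t + r) + f (x, t) = r * (fx (\<xi>, t + r) - fx (\<xi>, t))"
    by (auto simp: algebra_simps)
  have "\<exists>\<eta>. t < \<eta> \<and> \<eta> < t + r \<and> fx (\<xi>, t + r) - fx (\<xi>, t) = ((t + r) - t) * fxt (\<xi>, \<eta>)"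
  proof (rule MVT2)
    show "((\<lambda>s. fx (\<xi>, s)) has_real_derivative fxt (\<xi>, y)) (at y)" if "t \<le> y" "y \<le> t + r" for y
      using that S \<xi> by (auto intro!: fxt simp: has_real_derivative_iff_has_vector_derivative)
  qed (use r in auto)
  then obtain \<eta> where "t < \<eta>" "\<eta> < t + r" "fx (\<xi>, t + r) - fx (\<xi>, t) = r * fxt (\<xi>, \<eta>)"
    by auto
  with \<xi> show ?thesis by (intro that[of \<xi> \<eta>]) auto
qed

text \<open>
  On a small square the second difference equals \<open>r\<^sup>2\<close> times a value of either mixed derivative, so
  there are points close to \<open>(x0, t0)\<close> at which the two mixed derivatives agree with each other; by
  continuity they agree in \<open>(x0, t0)\<close>. Derivatives are given as explicit functions so that the
  result can be applied to the components of a vector-valued function.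
\<close>

lemma mixed_partials_eq_real:
  fixes f fx ft fxt ftx :: "real \<times> real \<Rightarrow> real"
  assumes S: "open S" "(x0, t0) \<in> S"
    and fx: "\<And>x t. (x, t) \<in> S \<Longrightarrow> ((\<lambda>s. f (s, t)) has_vector_derivative fx (x, t)) (at x)"
    and ft: "\<And>x t. (x, t) \<in> S \<Longrightarrow> ((\<lambda>s. f (x, s)) has_vector_derivative ft (x, t)) (at t)"
    and fxt: "\<And>x t. (x, t) \<in> S \<Longrightarrow> ((\<lambda>s. fx (x, s)) has_vector_derivative fxt (x, t)) (at t)"
    and ftx: "\<And>x t. (x, t) \<in> S \<Longrightarrow> ((\<lambda>s. ft (s, t)) has_vector_derivative ftx (x, t)) (at x)"
    and cont: "continuous_on S fxt" "continuous_on S ftx"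
  shows "fxt (x0, t0) = ftx (x0, t0)"
proof (rule ccontr)
  assume neq: "fxt (x0, t0) \<noteq> ftx (x0, t0)"
  define e where "e = dist (fxt (x0, t0)) (ftx (x0, t0)) / 2"
  have e: "e > 0" using neq by (simp add: e_def)
  have "eventually (\<lambda>p. p \<in> S \<and> dist (fxt p) (fxt (x0, t0)) < e \<and> dist (ftx p) (ftx (x0, t0)) < e)
      (nhds (x0, t0))"
  proof (intro eventually_conj)
    show "eventually (\<lambda>p. p \<in> S) (nhds (x0, t0))" using S by (rule eventually_nhds_in_open)
    have "(fxt \<longlongrightarrow> fxt (x0, t0)) (nhds (x0, t0))" "(ftx \<longlongrightarrow> ftx (x0, t0)) (nhds (x0, t0))"
      using cont S by (auto simp: continuous_on_eq_continuous_at isCont_def tendsto_at_iff_tendsto_nhds)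
    then show "eventually (\<lambda>p. dist (fxt p) (fxt (x0, t0)) < e) (nhds (x0, t0))"
      "eventually (\<lambda>p. dist (ftx p) (ftx (x0, t0)) < e) (nhds (x0, t0))"
      using e by (auto dest: tendstoD)
  qed
  then obtain d where d: "d > 0" and near: "\<And>p. dist p (x0, t0) < d \<Longrightarrow>
      p \<in> S \<and> dist (fxt p) (fxt (x0, t0)) < e \<and> dist (ftx p) (ftx (x0, t0)) < e"
    by (auto simp: eventually_nhds_metric)
  define r where "r = d / 3"
  have r: "r > 0" using d by (simp add: r_def)
  have box: "dist (x, t) (x0, t0) < d" if "x \<in> {x0..x0+r}" "t \<in> {t0..t0+r}" for x t
  proof -
    have "dist (x, t) (x0, t0) \<le> \<bar>x - x0\<bar> + \<bar>t - t0\<bar>"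
      using sqrt_sum_squares_le_sum_abs[of "x - x0" "t - t0"]
      by (simp add: dist_Pair_Pair dist_real_def)
    also have "\<dots> < d" using that d by (auto simp: r_def)
    finally show ?thesis .
  qed
  obtain \<xi> \<eta> where 1: "\<xi> \<in> {x0..x0+r}" "\<eta> \<in> {t0..t0+r}"
      "f (x0 + r, t0 + r) - f (x0 + r, t0) - f (x0, t0 + r) + f (x0, t0) = r * (r * fxt (\<xi>, \<eta>))"
    by (rule second_difference_mean_value[OF r _ fx fxt]) (use near box in auto)
  \<comment> \<open>The other order of differentiation is the same statement with the variables exchanged.\<close>
  let ?swap = "\<lambda>g (t, x). g (x, t)"
  obtain \<eta>' \<xi>' where 2: "\<eta>' \<in> {t0..t0+r}" "\<xi>' \<in> {x0..x0+r}"
      "?swap f (t0 + r, x0 + r) - ?swap f (t0 + r, x0) - ?swap f (t0, x0 + r) + ?swap f (t0, x0)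
        = r * (r * ?swap ftx (\<eta>', \<xi>'))"
    by (rule second_difference_mean_value[OF r, where x = t0 and t = x0 and S = "{(t, x). (x, t) \<in> S}"
          and f = "?swap f" and fx = "?swap ft" and fxt = "?swap ftx"])
      (use near box ft ftx in auto)
  have "fxt (\<xi>, \<eta>) = ftx (\<xi>', \<eta>')"
  proof -
    have "r * (r * fxt (\<xi>, \<eta>)) = r * (r * ftx (\<xi>', \<eta>'))"
      using 1(3) 2(3) by (simp add: algebra_simps)
    then show ?thesis using r by simp
  qed
  moreover have "dist (fxt (\<xi>, \<eta>)) (fxt (x0, t0)) < e" "dist (ftx (\<xi>', \<eta>')) (ftx (x0, t0)) < e"
    using near box 1 2 by blast+
  ultimately show False
    using dist_triangle_half_r[of "fxt (\<xi>, \<eta>)" "fxt (x0, t0)" "2 * e" "ftx (x0, t0)"]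
    by (simp add: e_def)
qed

lemma mixed_partials_eq:
  fixes f :: "real \<times> real \<Rightarrow> 'a::euclidean_space"
  assumes S: "open S" "p \<in> S"
    and f: "has_partials_on f S" "has_partials_on (partial_x f) S" "has_partials_on (partial_t f) S"
    and cont: "continuous_on S (partial_t (partial_x f))" "continuous_on S (partial_x (partial_t f))"
  shows "partial_t (partial_x f) p = partial_x (partial_t f) p"
proof (rule euclidean_eqI)
  fix i :: 'a assume "i \<in> Basis"
  obtain x t where xt: "p = (x, t)" by (cases p)
  note inner_deriv = bounded_linear.has_vector_derivative[OF bounded_linear_inner_left]
  have "partial_t (partial_x f) (x, t) \<bullet> i = partial_x (partial_t f) (x, t) \<bullet> i"
    using S xt
    by (intro mixed_partials_eq_real[of S x t "\<lambda>p. f p \<bullet> i" "\<lambda>p. partial_x f p \<bullet> i" "\<lambda>p. partial_t f p \<bullet> i"])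
      (auto intro!: inner_deriv has_partials_onD f continuous_on_inner cont continuous_on_const)
  then show "partial_t (partial_x f) p \<bullet> i = partial_x (partial_t f) p \<bullet> i"
    by (simp add: xt)
qed

section \<open>The d'Alembert decomposition\<close>

lemma extends_to_closure_imp_continuous_on:
  assumes "extends_to_closure f S"
  shows "continuous_on S f"
proof -
  obtain g where g: "continuous_on (closure S) g" "\<forall>p\<in>S. g p = f p"
    using assms by (auto simp: extends_to_closure_def)
  have "continuous_on S g"
    using g(1) closure_subset by (rule continuous_on_subset)
  then show ?thesis
    by (rule continuous_on_eq) (use g(2) in auto)
qed

text \<open>
  Write \<open>W(u, v)\<close> for \<open>w\<close> in characteristic coordinates. The derivative of \<open>W\<close> in \<open>v\<close> is half of
  \<open>g = w\<^sub>x - w\<^sub>t\<close>, and \<open>g\<close> does not depend on \<open>u\<close>. So \<open>W(u, v) - W(0, v)\<close> does not depend on \<open>v\<close>,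
  and comparison with \<open>v = 0\<close> gives the formula.
\<close>

lemma dAlembert_decomposition:
  fixes w :: "real \<times> real \<Rightarrow> 'a::euclidean_space"
  assumes b: "b > 0" and w: "C2_closure w (wave_square b)"
    and wave: "\<forall>p \<in> wave_square b. partial_x (partial_x w) p - partial_t (partial_t w) p = 0"
    and p: "(x, t) \<in> wave_square b"
  shows "w (x, t) = w ((x + t) / 2, (x + t) / 2) + w ((x - t) / 2, - (x - t) / 2) - w (0, 0)"
proof -
  define S where "S = wave_square b"
  have S: "open S" by (simp add: S_def wave_square_def)
  have char: "((u + v) / 2, (u - v) / 2) \<in> S" if "\<bar>u\<bar> < 2 * b" "\<bar>v\<bar> < 2 * b" for u v
  proof -
    have "(u + v) / 2 + (u - v) / 2 = u" "(u + v) / 2 - (u - v) / 2 = v"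
      by (simp_all add: field_simps)
    with that show ?thesis by (simp add: S_def wave_square_eq[OF b])
  qed
  have part: "has_partials_on w S" "has_partials_on (partial_x w) S" "has_partials_on (partial_t w) S"
    and cont: "continuous_on S (partial_t w)" "continuous_on S (partial_t (partial_x w))"
      "continuous_on S (partial_x (partial_t w))" "continuous_on S (partial_t (partial_t w))"
    using w by (auto simp: C2_closure_def S_def intro!: extends_to_closure_imp_continuous_on)
  have chain: "((\<lambda>s. f (q s)) has_vector_derivative h *\<^sub>R partial_x f (q s) + k *\<^sub>R partial_t f (q s)) (at s)"
    if f: "has_partials_on f S" "continuous_on S (partial_t f)"
      and q: "(q has_vector_derivative (h, k)) (at s)" "q s \<in> S"
    for f :: "real \<times> real \<Rightarrow> 'a" and q :: "real \<Rightarrow> real \<times> real" and h k s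
  proof -
    have "(f has_derivative (\<lambda>(h, k). h *\<^sub>R partial_x f (q s) + k *\<^sub>R partial_t f (q s))) (at (q s))"
      using has_derivative_from_partials[OF S _ f, of "fst (q s)" "snd (q s)"] q(2) by simp
    from has_derivative_compose[OF q(1)[unfolded has_vector_derivative_def] this]
    show ?thesis by (simp add: has_vector_derivative_def scaleR_right_distrib)
  qed
  let ?I = "{- 2 * b<..<2 * b}"
  define g where "g u v = partial_x w ((u + v) / 2, (u - v) / 2) - partial_t w ((u + v) / 2, (u - v) / 2)" for u v
  have g_const: "g u v = g u' v" if "u \<in> ?I" "u' \<in> ?I" "v \<in> ?I" for u u' v
  proof (rule has_derivative_zero_unique[of ?I "\<lambda>s. g s v"])
    fix s assume s: "s \<in> ?I"
    define q where "q s = ((s + v) / 2, (s - v) / 2)" for s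
    have q: "(q has_vector_derivative (1/2, 1/2)) (at s)"
      unfolding q_def has_vector_derivative_def by (auto intro!: derivative_eq_intros)
    have qS: "q s \<in> S" using s that by (auto simp: q_def intro: char)
    have "partial_x (partial_x w) (q s) = partial_t (partial_t w) (q s)"
      using wave qS by (simp add: S_def)
    moreover have "partial_t (partial_x w) (q s) = partial_x (partial_t w) (q s)"
      using S qS part cont by (intro mixed_partials_eq)
    moreover have "((\<lambda>s. partial_x w (q s) - partial_t w (q s)) has_vector_derivative
        (1/2) *\<^sub>R partial_x (partial_x w) (q s) + (1/2) *\<^sub>R partial_t (partial_x w) (q s)
        - ((1/2) *\<^sub>R partial_x (partial_t w) (q s) + (1/2) *\<^sub>R partial_t (partial_t w) (q s))) (at s)"
      by (intro has_vector_derivative_diff chain q qS part cont)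
    ultimately have "((\<lambda>s. g s v) has_vector_derivative 0) (at s)"
      by (simp add: g_def q_def)
    then show "((\<lambda>s. g s v) has_derivative (\<lambda>h. 0)) (at s within ?I)"
      by (auto simp: has_vector_derivative_def intro: has_derivative_at_withinI)
  qed (use that in auto)
  define W where "W u v = w ((u + v) / 2, (u - v) / 2)" for u v
  have W_deriv: "((\<lambda>s. W u s) has_vector_derivative (1/2) *\<^sub>R g u v) (at v)"
    if "u \<in> ?I" "v \<in> ?I" for u v
  proof -
    have q: "((\<lambda>s. ((u + s) / 2, (u - s) / 2)) has_vector_derivative (1/2, - 1/2)) (at v)"
      unfolding has_vector_derivative_def by (auto intro!: derivative_eq_intros)
    show ?thesis
      using chain[OF part(1) cont(1) q] char[of u v] that
      by (simp add: W_def g_def scaleR_right_diff_distrib abs_less_iff)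
  qed
  define u v where "u = x + t" and "v = x - t"
  have uv: "u \<in> ?I" "v \<in> ?I" and zero: "0 \<in> ?I"
    using p b by (auto simp: wave_square_eq u_def v_def)
  have "W u v - W 0 v = W u 0 - W 0 0"
  proof (rule has_derivative_zero_unique[of ?I "\<lambda>s. W u s - W 0 s"])
    fix s assume s: "s \<in> ?I"
    have "((\<lambda>s. W u s - W 0 s) has_vector_derivative (1/2) *\<^sub>R g u s - (1/2) *\<^sub>R g 0 s) (at s)"
      by (intro has_vector_derivative_diff W_deriv uv zero s)
    then show "((\<lambda>s. W u s - W 0 s) has_derivative (\<lambda>h. 0)) (at s within ?I)"
      using g_const[OF uv(1) zero s]
      by (auto simp: has_vector_derivative_def intro: has_derivative_at_withinI)
  qed (use uv zero in auto)
  moreover have "W u v = w (x, t)" by (simp add: W_def u_def v_def)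
  moreover have "W u 0 = w (u / 2, u / 2)" "W 0 v = w (v / 2, - v / 2)" "W 0 0 = w (0, 0)"
    by (simp_all add: W_def)
  ultimately show ?thesis
    unfolding u_def[symmetric] v_def[symmetric] by (simp add: algebra_simps)
qed

section \<open>Uniform approximation by polynomials of bounded degree\<close>

lemma uniform_limit_Bernstein:
  fixes f :: "real \<Rightarrow> real"
  assumes "continuous_on {0..1} f"
  shows "uniform_limit {0..1} (\<lambda>n x. \<Sum>k\<le>n. f (k / n) * Bernstein n k x) f sequentially"
proof (rule uniform_limitI)
  fix e :: real assume "e > 0"
  with Bernstein_Weierstrass[OF assms] obtain N where
    "\<And>n x. N \<le> n \<Longrightarrow> x \<in> {0..1} \<Longrightarrow> \<bar>f x - (\<Sum>k\<le>n. f (k / n) * Bernstein n k x)\<bar> < e"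
    by blast
  then show "\<forall>\<^sub>F n in sequentially. \<forall>x\<in>{0..1}. dist (\<Sum>k\<le>n. f (k / n) * Bernstein n k x) (f x) < e"
    unfolding eventually_sequentially
    by (intro exI[of _ N]) (simp add: dist_real_def abs_minus_commute)
qed

text \<open>
  The \<open>n\<close>-th Bernstein polynomial has degree at most \<open>n\<close>, and the affine substitution that carries
  \<open>[-r, r]\<close> to \<open>[0, 1]\<close> does not change the degree. This ties the degree to the index of the
  sequence, which bare density of the polynomials would not give.
\<close>

lemma Weierstrass_real:
  fixes f :: "real \<Rightarrow> real"
  assumes r: "r > 0" and f: "continuous_on {-r..r} f"
  shows "\<exists>c :: nat \<Rightarrow> nat \<Rightarrow> real.
    uniform_limit {-r..r} (\<lambda>n y. \<Sum>i\<le>n. y ^ i * c n i) f sequentially"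
proof -
  define g where "g x = f (2 * r * x - r)" for x
  define h where "h y = (y + r) / (2 * r)" for y
  \<comment> \<open>The two linear factors are \<open>h y\<close> and \<open>1 - h y\<close> as polynomials in \<open>y\<close>, so that \<open>P n\<close> is the
    Bernstein polynomial of \<open>g\<close> composed with \<open>h\<close>.\<close>
  define P where "P n = (\<Sum>k\<le>n. smult (g (k / n) * real (n choose k))
      ([:1/2, 1/(2*r):] ^ k * [:1/2, - 1/(2*r):] ^ (n - k)))" for n
  have "continuous_on {0..1} g"
    unfolding g_def using r
    by (intro continuous_on_compose2[OF f] continuous_intros) (auto simp: field_simps)
  then have lim: "uniform_limit {0..1} (\<lambda>n x. \<Sum>k\<le>n. g (k / n) * Bernstein n k x) g sequentially"
    by (rule uniform_limit_Bernstein)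
  have h: "h y \<in> {0..1}" if "y \<in> {-r..r}" for y
    using that r by (auto simp: h_def field_simps)
  have gh: "g (h y) = f y" for y
    using r by (simp add: g_def h_def)
  have hy: "1/2 + y / (2 * r) = h y" "1/2 - y / (2 * r) = 1 - h y" for y
    using r by (auto simp: h_def field_simps)
  have "degree (P n) \<le> n" for n
    unfolding P_def
  proof (intro degree_sum_le)
    fix k assume "k \<in> {..n}"
    have lin: "degree ([:1/2, a:] ^ j) \<le> j" for a :: real and j
      using degree_power_le[of "[:1/2, a:]" j] degree_pCons_le[of "1/2" "[:a:]"]
      by (simp split: if_splits)
    have "degree ([:1/2, 1/(2*r):] ^ k * [:1/2, - 1/(2*r):] ^ (n - k)) \<le> k + (n - k)"
      by (rule order.trans[OF degree_mult_le]) (intro add_mono lin)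
    then show "degree (smult (g (k / n) * real (n choose k))
      ([:1/2, 1/(2*r):] ^ k * [:1/2, - 1/(2*r):] ^ (n - k))) \<le> n"
      using \<open>k \<in> {..n}\<close> by (intro order.trans[OF degree_smult_le]) auto
  qed auto
  then have "(\<Sum>i\<le>n. y ^ i * coeff (P n) i) = poly (P n) y" for n y
    unfolding poly_altdef
    by (intro sum.mono_neutral_cong_right) (auto simp: coeff_eq_0 mult.commute)
  also have "\<And>n y. poly (P n) y = (\<Sum>k\<le>n. g (k / n) * Bernstein n k (h y))"
    by (simp add: P_def poly_sum Bernstein_def hy mult.assoc)
  finally have eq: "\<And>n y. (\<Sum>i\<le>n. y ^ i * coeff (P n) i) = (\<Sum>k\<le>n. g (k / n) * Bernstein n k (h y))" .
  have "uniform_limit {-r..r} (\<lambda>n y. \<Sum>i\<le>n. y ^ i * coeff (P n) i) f sequentially"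
    using uniform_limit_compose'[OF lim, of h "{-r..r}"] h by (simp add: eq gh)
  then show ?thesis by (rule exI[of _ "\<lambda>n. coeff (P n)"])
qed

lemma uniform_limit_sum:
  fixes f :: "'i \<Rightarrow> 'b \<Rightarrow> 'c \<Rightarrow> 'a::real_normed_vector"
  assumes "\<And>i. i \<in> I \<Longrightarrow> uniform_limit X (f i) (l i) F"
  shows "uniform_limit X (\<lambda>n x. \<Sum>i\<in>I. f i n x) (\<lambda>x. \<Sum>i\<in>I. l i x) F"
  using assms
  by (induction I rule: infinite_finite_induct) (auto intro: uniform_limit_const uniform_limit_add)

lemma Weierstrass_euclidean:
  fixes f :: "real \<Rightarrow> 'a::euclidean_space"
  assumes r: "r > 0" and f: "continuous_on {-r..r} f"
  shows "\<exists>c :: nat \<Rightarrow> nat \<Rightarrow> 'a.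
    uniform_limit {-r..r} (\<lambda>n y. \<Sum>i\<le>n. y ^ i *\<^sub>R c n i) f sequentially"
proof -
  have "\<forall>e. \<exists>c :: nat \<Rightarrow> nat \<Rightarrow> real.
    uniform_limit {-r..r} (\<lambda>n y. \<Sum>i\<le>n. y ^ i * c n i) (\<lambda>y. f y \<bullet> e) sequentially"
    by (intro allI Weierstrass_real r continuous_intros f)
  from choice[OF this] obtain c :: "'a \<Rightarrow> nat \<Rightarrow> nat \<Rightarrow> real" where c:
    "\<And>e. uniform_limit {-r..r} (\<lambda>n y. \<Sum>i\<le>n. y ^ i * c e n i) (\<lambda>y. f y \<bullet> e) sequentially"
    by blast
  have "uniform_limit {-r..r} (\<lambda>n y. \<Sum>e\<in>Basis. (\<Sum>i\<le>n. y ^ i * c e n i) *\<^sub>R e)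
      (\<lambda>y. \<Sum>e\<in>Basis. (f y \<bullet> e) *\<^sub>R e) sequentially"
    by (intro uniform_limit_sum c bounded_linear.uniform_limit[OF bounded_linear_scaleR_left])
  moreover have "(\<Sum>e\<in>Basis. (\<Sum>i\<le>n. y ^ i * c e n i) *\<^sub>R e) =
      (\<Sum>i\<le>n. y ^ i *\<^sub>R (\<Sum>e\<in>Basis. c e n i *\<^sub>R e))" for n y
    unfolding scaleR_sum_left scaleR_sum_right by (subst sum.swap) simp
  ultimately have "uniform_limit {-r..r} (\<lambda>n y. \<Sum>i\<le>n. y ^ i *\<^sub>R (\<Sum>e\<in>Basis. c e n i *\<^sub>R e)) f sequentially"
    by (simp add: euclidean_representation)
  then show ?thesis by (rule exI[of _ "\<lambda>n i. \<Sum>e\<in>Basis. c e n i *\<^sub>R e"])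
qed

section \<open>Wave polynomials and powers of the characteristic coordinates\<close>

text \<open>
  The coefficients that rewrite \<open>\<Sum> c\<^sub>i u\<^sup>i + \<Sum> d\<^sub>i v\<^sup>i\<close> in wave polynomials: \<open>p\<^bsub>2i-1\<^esub>\<close> occurs in both
  \<open>u\<^sup>i\<close> and \<open>v\<^sup>i\<close> with factor \<open>1\<close>, whereas \<open>p\<^bsub>2i\<^esub>\<close> occurs with factors \<open>1\<close> and \<open>-1\<close>. The constant
  terms of both sums are collected in \<open>p\<^sub>0 = 1\<close>.
\<close>

definition wave_coeff :: "(nat \<Rightarrow> 'a::real_normed_field) \<Rightarrow> (nat \<Rightarrow> 'a) \<Rightarrow> nat \<Rightarrow> 'a" where
  "wave_coeff c d n =
    (if n = 0 then c 0 + d 0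
     else if odd n then c ((n + 1) div 2) + d ((n + 1) div 2)
     else c (n div 2) - d (n div 2))"

lemma sum_wave_coeff:
  "(\<Sum>n=0..2 * m. wave_coeff c d n * of_real (wave_poly n x t))
    = (\<Sum>i\<le>m. (x + t) ^ i *\<^sub>R c i) + (\<Sum>i\<le>m. (x - t) ^ i *\<^sub>R d i)"
proof (induction m)
  case 0
  show ?case by (simp add: wave_coeff_def wave_poly_def)
next
  case (Suc m)
  have "(c' + d') * of_real ((p + q) / 2) + (c' - d') * of_real ((p - q) / 2) = p *\<^sub>R c' + q *\<^sub>R d'"
    for c' d' :: 'a and p q :: real
    by (simp add: scaleR_conv_of_real of_real_divide add_divide_distrib diff_divide_distrib distrib_left algebra_simps)
  from this[of "c (Suc m)" "d (Suc m)" "(x + t) ^ Suc m" "(x - t) ^ Suc m"] 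
  have "wave_coeff c d (Suc (2 * m)) * of_real (wave_poly (Suc (2 * m)) x t)
      + wave_coeff c d (Suc (Suc (2 * m))) * of_real (wave_poly (Suc (Suc (2 * m))) x t)
    = (x + t) ^ Suc m *\<^sub>R c (Suc m) + (x - t) ^ Suc m *\<^sub>R d (Suc m)"
    by (simp add: wave_coeff_def wave_poly_def del: power_Suc)
  with Suc.IH show ?case
    by (simp add: add_ac del: power_Suc)
qed

text \<open>For odd \<open>N\<close> the last wave polynomial \<open>p\<^sub>N\<close> receives the coefficient zero, since its partner
  \<open>p\<^bsub>N+1\<^esub>\<close> is out of range.\<close>

lemma sum_wave_coeff_truncated:
  assumes "m = N div 2"
  shows "(\<Sum>n=0..N. (if n \<le> 2 * m then wave_coeff c d n else 0) * of_real (wave_poly n x t))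
    = (\<Sum>i\<le>m. (x + t) ^ i *\<^sub>R c i) + (\<Sum>i\<le>m. (x - t) ^ i *\<^sub>R d i)"
  unfolding sum_wave_coeff[symmetric] using assms
  by (intro sum.mono_neutral_cong_right) auto

theorem theorem3:
  fixes b :: real and w :: "real \<times> real \<Rightarrow> 'a::{real_normed_field,euclidean_space}"
  assumes "b > 0"
    and "C2_closure w (wave_square b)"
    and "\<forall>p \<in> wave_square b. partial_x (partial_x w) p - partial_t (partial_t w) p = 0"
  shows "\<exists>a :: nat \<Rightarrow> nat \<Rightarrow> 'a.
    uniform_limit (closure (wave_square b))
      (\<lambda>N (x, t). \<Sum>n=0..N. a N n * of_real (wave_poly n x t)) w sequentially"
proof -
  let ?S = "wave_square b"
  define F where "F u = w (u / 2, u / 2)" for u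
  define G where "G v = w (v / 2, - v / 2) - w (0, 0)" for v
  have K: "closure ?S = {(x, t). \<bar>x + t\<bar> \<le> 2 * b \<and> \<bar>x - t\<bar> \<le> 2 * b}"
    by (rule closure_wave_square) fact
  have cw: "continuous_on (closure ?S) w"
    using assms(2) by (simp add: C2_closure_def)
  \<comment> \<open>The points \<open>(u/2, u/2)\<close> and \<open>(v/2, -v/2)\<close> stay in the closed square up to \<open>\<bar>u\<bar> = \<bar>v\<bar> = 2b\<close>.\<close>
  have cF: "continuous_on {- (2 * b)..2 * b} F" and cG: "continuous_on {- (2 * b)..2 * b} G"
    unfolding F_def G_def
    by (intro continuous_intros continuous_on_compose2[OF cw]; use assms(1) in \<open>force simp: K\<close>)+
  have split: "w p = F (fst p + snd p) + G (fst p - snd p)" if "p \<in> closure ?S" for p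
  proof -
    have "w p - (F (fst p + snd p) + G (fst p - snd p)) = 0"
    proof (rule continuous_constant_on_closure[OF _ _ that])
      show "continuous_on (closure ?S) (\<lambda>p. w p - (F (fst p + snd p) + G (fst p - snd p)))"
        by (intro continuous_intros cw continuous_on_compose2[OF cF] continuous_on_compose2[OF cG])
          (auto simp: K)
      show "w p - (F (fst p + snd p) + G (fst p - snd p)) = 0" if "p \<in> ?S" for p
        using dAlembert_decomposition[OF assms, of "fst p" "snd p"] that by (simp add: F_def G_def)
    qed
    then show ?thesis by simp
  qed
  obtain c where c: "uniform_limit {- (2 * b)..2 * b} (\<lambda>n y. \<Sum>i\<le>n. y ^ i *\<^sub>R c n i) F sequentially"
    using Weierstrass_euclidean[OF _ cF] assms(1) by auto
  obtain d where d: "uniform_limit {- (2 * b)..2 * b} (\<lambda>n y. \<Sum>i\<le>n. y ^ i *\<^sub>R d n i) G sequentially"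
    using Weierstrass_euclidean[OF _ cG] assms(1) by auto
  have half: "filterlim (\<lambda>N. N div 2) sequentially (sequentially :: nat filter)"
    by (rule filterlim_at_top_div_const_nat) simp
  define a where "a N n = (if n \<le> 2 * (N div 2) then wave_coeff (c (N div 2)) (d (N div 2)) n else 0)" for N n
  have a: "(\<lambda>(x, t). \<Sum>n=0..N. a N n * of_real (wave_poly n x t)) =
      (\<lambda>p. (\<Sum>i\<le>N div 2. (fst p + snd p) ^ i *\<^sub>R c (N div 2) i)
         + (\<Sum>i\<le>N div 2. (fst p - snd p) ^ i *\<^sub>R d (N div 2) i))" for N
    unfolding a_def by (auto simp: sum_wave_coeff_truncated[OF refl])
  have "uniform_limit (closure ?S)
      (\<lambda>N p. (\<Sum>i\<le>N div 2. (fst p + snd p) ^ i *\<^sub>R c (N div 2) i)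
           + (\<Sum>i\<le>N div 2. (fst p - snd p) ^ i *\<^sub>R d (N div 2) i))
      (\<lambda>p. F (fst p + snd p) + G (fst p - snd p)) sequentially"
    by (intro uniform_limit_add
        uniform_limit_compose'[OF filterlim_compose[OF c half], where h = "\<lambda>p. fst p + snd p"]
        uniform_limit_compose'[OF filterlim_compose[OF d half], where h = "\<lambda>p. fst p - snd p"])
      (auto simp: K)
  then have "uniform_limit (closure ?S) (\<lambda>N (x, t). \<Sum>n=0..N. a N n * of_real (wave_poly n x t)) w sequentially"
    unfolding a by (rule uniform_limit_cong'[THEN iffD1, rotated -1]) (auto simp: split)
  then show ?thesis by blast
qed

end
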